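(* Let $\rho\ge 1$, $\ell\ge 1$, and $b\ge 2$ be integers and let $\lambda=\ell\rho(\rho+1)/2$. Let $C_b^\Lambda(n)$ be the number of $\rho$-color $b$-ary partitions of $n$ in which the multiplicity of each occurring part with color $i$ is one of $i,2i,\ldots,\ell i$, and let $Y_n$ be the number of ordinary partitions of $n$ with each part bounded by $\rho$ and occurring at most $\ell$ times. Then for all integers $n\ge 0$, $$C_b^\Lambda(bn+j)=\sum_{k=0}^{\lfloor\lambda/b\rfloor}Y_{bk+j}\,C_b^\Lambda(n-k)\qquad (j=0,1,\ldots,b-1).$$
   Context: A $\rho$-color $b$-ary partition of $n$ is a finite multiset of colored parts, each being a power $b^j$ ($j\ge0$) with a color $i\in\{1,\dots,\rho\}$, with sum $n$ (order irrelevant). The multiplicity condition means that each colored part $(b^j,i)$ occurs $0$, $i$, $2i,\ldots,$ or $\ell i$ times. Conventions: $C_b^\Lambda(0)=1$, $C_b^\Lambda(m)=0$ for $m<0$, and $Y_0=1$. Equivalently, $\sum_{n\ge0}C_b^\Lambda(n)q^n=\prod_{j=0}^\infty\prod_{i=1}^\rho\left(1+q^{ib^j}+q^{2ib^j}+\cdots+q^{\ell ib^j}\right)$ and $\sum_{n=0}^{\lambda}Y_nq^n=\prod_{i=1}^\rho\left(1+q^i+q^{2i}+\cdots+q^{\ell i}\right)$. Here $\Lambda=(\ell,2\ell,\ldots,\rho\ell)$ is only a label in the notation. *)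

theory Defs
  imports "HOL-Library.Multiset"
begin

text \<open>
  A colored part is a pair \<open>(p, i)\<close> of its size \<open>p = b ^ j\<close> and its color \<open>i\<close>; since \<open>b \<ge> 2\<close>, the
  size determines the exponent \<open>j\<close>. The number \<open>n\<close> to be partitioned is an integer, so that
  negative arguments are meaningful; they admit no partitions.
\<close>

definition colored_bary_partitions :: "nat \<Rightarrow> nat \<Rightarrow> int \<Rightarrow> (nat \<times> nat) multiset set" where
  "colored_bary_partitions b \<rho> n =
     {M. set_mset M \<subseteq> range (\<lambda>j. b ^ j) \<times> {1..\<rho>} \<and> int (\<Sum>x\<in>#M. fst x) = n}"

definition C_partitions :: "nat \<Rightarrow> nat \<Rightarrow> nat \<Rightarrow> int \<Rightarrow> (nat \<times> nat) multiset set" where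
  "C_partitions b \<rho> l n =
     {M \<in> colored_bary_partitions b \<rho> n.
        \<forall>(p, i)\<in>#M. count M (p, i) \<in> (\<lambda>t. t * i) ` {1..l}}"

text \<open>
  The label \<open>\<Lambda> = (l, 2 l, \<dots>, \<rho> l)\<close> is represented by the two parameters \<open>\<rho>\<close> and \<open>l\<close>.
\<close>

definition C :: "nat \<Rightarrow> nat \<Rightarrow> nat \<Rightarrow> int \<Rightarrow> nat" where
  "C b \<rho> l n = card (C_partitions b \<rho> l n)"

definition Y_partitions :: "nat \<Rightarrow> nat \<Rightarrow> nat \<Rightarrow> nat multiset set" where
  "Y_partitions \<rho> l n =
     {M. set_mset M \<subseteq> {1..\<rho>} \<and> (\<forall>i\<in>#M. count M i \<le> l) \<and> sum_mset M = n}"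

definition Y :: "nat \<Rightarrow> nat \<Rightarrow> nat \<Rightarrow> nat" where
  "Y \<rho> l n = card (Y_partitions \<rho> l n)"

text \<open>
  Finiteness of the sets counted above, so that \<open>card\<close> is their true cardinality, and the
  conventions for \<open>C\<close> and \<open>Y\<close> at nonpositive arguments.
\<close>

lemma finite_multisets_bounded:
  assumes "finite A"
  shows "finite {M. set_mset M \<subseteq> A \<and> size M \<le> n}"
proof -
  have "{M. set_mset M \<subseteq> A \<and> size M \<le> n} \<subseteq> mset ` {xs. set xs \<subseteq> A \<and> length xs \<le> n}"
  proof
    fix M assume "M \<in> {M. set_mset M \<subseteq> A \<and> size M \<le> n}"
    moreover obtain xs where "M = mset xs" by (metis ex_mset)
    ultimately show "M \<in> mset ` {xs. set xs \<subseteq> A \<and> length xs \<le> n}" by auto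
  qed
  then show ?thesis
    using finite_lists_length_le[OF assms] finite_surj by blast
qed

lemma size_le_sum_mset:
  fixes f :: "'a \<Rightarrow> nat"
  assumes "\<And>x. x \<in># M \<Longrightarrow> f x \<ge> 1"
  shows "size M \<le> (\<Sum>x\<in>#M. f x)"
  using assms
proof (induction M)
  case (add x M)
  have "size M \<le> (\<Sum>x\<in>#M. f x)" "f x \<ge> 1" using add by auto
  then show ?case by simp
qed simp

lemma finite_C_partitions:
  assumes "b \<ge> 2"
  shows "finite (C_partitions b \<rho> l n)"
proof -
  have "C_partitions b \<rho> l n \<subseteq> {M. set_mset M \<subseteq> {..nat n} \<times> {1..\<rho>} \<and> size M \<le> nat n}"
  proof
    fix M assume "M \<in> C_partitions b \<rho> l n"
    then have M: "set_mset M \<subseteq> range (\<lambda>j. b ^ j) \<times> {1..\<rho>}" and "int (\<Sum>x\<in>#M. fst x) = n"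
      unfolding C_partitions_def colored_bary_partitions_def by blast+
    then have n: "(\<Sum>x\<in>#M. fst x) = nat n" by (metis nat_int)
    have "fst x \<ge> 1" if "x \<in># M" for x
      using M that assms by (auto simp: Suc_le_eq)
    then have "size M \<le> nat n" using size_le_sum_mset[of M fst] n by simp
    moreover have "fst x \<le> nat n" if "x \<in># M" for x
      using that n by (metis le_add1 insert_DiffM sum_mset.insert)
    ultimately show "M \<in> {M. set_mset M \<subseteq> {..nat n} \<times> {1..\<rho>} \<and> size M \<le> nat n}"
      using M by (auto simp: subset_iff)
  qed
  then show ?thesis
    using finite_multisets_bounded[of "{..nat n} \<times> {1..\<rho>}"] finite_subset by blast
qed

lemma finite_Y_partitions: "finite (Y_partitions \<rho> l n)"
proof -
  have "Y_partitions \<rho> l n \<subseteq> {M. set_mset M \<subseteq> {1..\<rho>} \<and> size M \<le> n}"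
  proof
    fix M assume "M \<in> Y_partitions \<rho> l n"
    then have M: "set_mset M \<subseteq> {1..\<rho>}" and n: "(\<Sum>x\<in>#M. x) = n"
      by (auto simp: Y_partitions_def)
    have "x \<ge> 1" if "x \<in># M" for x using M that by auto
    then have "size M \<le> n" using size_le_sum_mset[of M "\<lambda>x. x"] n by auto
    then show "M \<in> {M. set_mset M \<subseteq> {1..\<rho>} \<and> size M \<le> n}" using M by simp
  qed
  then show ?thesis
    using finite_multisets_bounded[of "{1..\<rho>}"] finite_subset by blast
qed

lemma C_neg: "n < 0 \<Longrightarrow> C b \<rho> l n = 0"
proof -
  assume "n < 0"
  then have "int k \<noteq> n" for k by linarith
  then have "C_partitions b \<rho> l n = {}"
    unfolding C_partitions_def colored_bary_partitions_def by blast
  then show ?thesis by (simp add: C_def)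
qed

lemma C_0:
  assumes "b \<ge> 2"
  shows "C b \<rho> l 0 = 1"
proof -
  have "C_partitions b \<rho> l 0 = {{#}}"
  proof (intro equalityI subsetI)
    fix M assume "M \<in> C_partitions b \<rho> l 0"
    then have M: "set_mset M \<subseteq> range (\<lambda>j. b ^ j) \<times> {1..\<rho>}" and "int (\<Sum>x\<in>#M. fst x) = 0"
      unfolding C_partitions_def colored_bary_partitions_def by blast+
    then have "(\<Sum>x\<in>#M. fst x) = 0" by (metis of_nat_eq_0_iff)
    moreover have "fst x \<ge> 1" if "x \<in># M" for x
      using M that assms by (auto simp: Suc_le_eq)
    ultimately have "size M \<le> 0" using size_le_sum_mset[of M fst] by metis
    then show "M \<in> {{#}}" by simp
  qed (simp add: C_partitions_def colored_bary_partitions_def)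
  then show ?thesis by (simp add: C_def)
qed

lemma Y_0: "Y \<rho> l 0 = 1"
proof -
  have "Y_partitions \<rho> l 0 = {{#}}"
  proof (intro equalityI subsetI)
    fix M assume "M \<in> Y_partitions \<rho> l 0"
    then have M: "set_mset M \<subseteq> {1..\<rho>}" and "(\<Sum>x\<in>#M. x) = 0"
      unfolding Y_partitions_def by simp_all
    moreover have "x \<ge> 1" if "x \<in># M" for x using M that by auto
    ultimately have "size M \<le> 0" using size_le_sum_mset[of M "\<lambda>x. x"] by metis
    then show "M \<in> {{#}}" by simp
  qed (simp add: Y_partitions_def)
  then show ?thesis by (simp add: Y_def)
qed

end

theory Submission
  imports Defs
begin

text \<open>
  In a colored partition of \<open>m\<close> one separates the parts of size \<open>b ^ 0 = 1\<close> from the larger ones.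
  All larger parts are divisible by \<open>b\<close>; dividing their sizes by \<open>b\<close> leaves an arbitrary colored
  partition of some \<open>r\<close>, with the same multiplicities. The units of color \<open>i\<close> come in a multiple
  \<open>t * i\<close> with \<open>t \<le> l\<close>; reading each bundle of \<open>i\<close> such units as one part of size \<open>i\<close>, occurring
  \<open>t\<close> times, gives an ordinary partition of \<open>m - b * r\<close> of the kind counted by \<open>Y\<close>. This is a
  bijection, so \<open>C(m)\<close> is the sum of \<open>Y(m - b * r) C(r)\<close> over all \<open>r \<le> m div b\<close>
  (lemma \<open>C_recurrence\<close>).

  For \<open>m = b * n + j\<close> with \<open>j < b\<close>, the substitution \<open>r = n - k\<close> turns this into the claimed sum,
  but over \<open>k \<le> n\<close>. Both ranges of \<open>k\<close> give the same value: \<open>C\<close> vanishes at negative arguments,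
  and \<open>Y\<close> vanishes above the largest possible sum \<open>l * (1 + \<dots> + \<rho>)\<close> (lemma \<open>Y_eq_0\<close>).
\<close>

text \<open>
  Allowing the multiplicity \<open>0 * i\<close> makes the condition meaningful for all pairs, not only for the
  occurring parts, so that it can be checked by computing \<open>count\<close>.
\<close>

lemma mem_C_partitions_iff:
  "M \<in> C_partitions b \<rho> l (int m) \<longleftrightarrow>
     set_mset M \<subseteq> range (\<lambda>j. b ^ j) \<times> {1..\<rho>} \<and>
     (\<forall>p i. \<exists>t\<le>l. count M (p, i) = t * i) \<and> (\<Sum>x\<in>#M. fst x) = m"
proof -
  have "(\<forall>(p, i)\<in>#M. count M (p, i) \<in> (\<lambda>t. t * i) ` {1..l}) \<longleftrightarrow>
        (\<forall>p i. \<exists>t\<le>l. count M (p, i) = t * i)" (is "?L \<longleftrightarrow> ?R")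
  proof
    assume L: ?L
    show ?R
    proof (intro allI)
      fix p i
      show "\<exists>t\<le>l. count M (p, i) = t * i"
      proof (cases "(p, i) \<in># M")
        case True
        then show ?thesis using L by fastforce
      next
        case False
        then show ?thesis by (auto simp: not_in_iff intro: exI[of _ 0])
      qed
    qed
  next
    assume R: ?R
    have "count M (p, i) \<in> (\<lambda>t. t * i) ` {1..l}" if "(p, i) \<in># M" for p i
    proof -
      obtain t where t: "t \<le> l" "count M (p, i) = t * i" using R by blast
      moreover have "t \<ge> 1" using t that by (cases t) (auto simp: count_eq_zero_iff)
      ultimately show ?thesis by auto
    qed
    then show ?L by blast
  qed
  then show ?thesis
    unfolding C_partitions_def colored_bary_partitions_def mem_Collect_eq of_nat_eq_iff by blast
qed

section \<open>Units and larger parts\<close>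

text \<open>
  A part of size \<open>i\<close> becomes a bundle of \<open>i\<close> parts \<open>(1, i)\<close>: this is how the size of a part on the
  \<open>Y\<close> side becomes a color, and why the multiplicities of color \<open>i\<close> are multiples of \<open>i\<close>.
\<close>

definition unit_parts :: "nat multiset \<Rightarrow> (nat \<times> nat) multiset" where
  "unit_parts N = (\<Sum>i\<in>#N. replicate_mset i (1, i))"

definition raise_parts :: "nat \<Rightarrow> (nat \<times> nat) multiset \<Rightarrow> (nat \<times> nat) multiset" where
  "raise_parts b M = image_mset (apfst ((*) b)) M"

lemma count_unit_parts: "count (unit_parts N) (p, i) = (if p = 1 then count N i * i else 0)"
  unfolding unit_parts_def by (induction N) auto

lemma sum_unit_parts: "(\<Sum>x\<in>#unit_parts N. fst x) = sum_mset N"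
  unfolding unit_parts_def by (induction N) auto

lemma set_unit_parts: "set_mset (unit_parts N) \<subseteq> {1} \<times> set_mset N"
  unfolding unit_parts_def by (auto split: if_splits)

lemma count_raise_parts_mult:
  assumes "b > 0"
  shows "count (raise_parts b M) (b * p, i) = count M (p, i)"
  unfolding raise_parts_def
proof (induction M)
  case (add x M)
  then show ?case using assms by (cases x) auto
qed simp

lemma count_raise_parts_not_dvd:
  assumes "\<not> b dvd p"
  shows "count (raise_parts b M) (p, i) = 0"
  using assms by (auto simp: raise_parts_def count_eq_zero_iff)

lemma sum_raise_parts: "(\<Sum>x\<in>#raise_parts b M. fst x) = b * (\<Sum>x\<in>#M. fst x)"
  unfolding raise_parts_def by (induction M) (auto simp: algebra_simps)

text \<open>
  The two summands of \<open>unit_parts N + raise_parts b M\<close> have disjoint supports, since \<open>b\<close> does not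
  divide \<open>1\<close>. Hence its multiplicities at size \<open>1\<close> depend on \<open>N\<close> alone, and those at multiples of
  \<open>b\<close> on \<open>M\<close> alone.
\<close>

lemma count_glued_unit:
  assumes "b \<ge> 2"
  shows "count (unit_parts N + raise_parts b M) (1, i) = count N i * i"
  using assms count_raise_parts_not_dvd[of b 1] by (simp add: count_unit_parts)

lemma count_glued_mult:
  assumes "b \<ge> 2"
  shows "count (unit_parts N + raise_parts b M) (b * p, i) = count M (p, i)"
  using assms by (simp add: count_unit_parts count_raise_parts_mult)

text \<open>
  Both components can be read off from multiplicities. A part \<open>0\<close> of \<open>N\<close> would give an empty bundle
  and leave no trace, so such parts have to be excluded.
\<close>

lemma glued_inject:
  assumes "b \<ge> 2" and "0 \<notin># N" and "0 \<notin># N'"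
    and eq: "unit_parts N + raise_parts b M = unit_parts N' + raise_parts b M'"
  shows "N = N' \<and> M = M'"
proof
  show "N = N'"
  proof (rule multiset_eqI)
    fix i
    have "count N i * i = count N' i * i"
      using eq count_glued_unit[OF assms(1)] by metis
    then show "count N i = count N' i"
      using assms(2,3) by (cases "i = 0") (simp_all add: not_in_iff)
  qed
  show "M = M'"
  proof (rule multiset_eqI)
    fix x :: "nat \<times> nat"
    show "count M x = count M' x"
      using eq count_glued_mult[OF assms(1)] by (metis surj_pair)
  qed
qed

section \<open>The bijection\<close>

lemma glued_mem_C_partitions:
  assumes b: "b \<ge> 2" and N: "N \<in> Y_partitions \<rho> l s" and M: "M \<in> C_partitions b \<rho> l (int r)"
  shows "unit_parts N + raise_parts b M \<in> C_partitions b \<rho> l (int (s + b * r))"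
proof -
  let ?G = "unit_parts N + raise_parts b M"
  have Ms: "set_mset M \<subseteq> range (\<lambda>j. b ^ j) \<times> {1..\<rho>}"
    and Mc: "\<And>p i. \<exists>t\<le>l. count M (p, i) = t * i" and Mr: "(\<Sum>x\<in>#M. fst x) = r"
    using M by (simp_all add: mem_C_partitions_iff)
  have Ns: "set_mset N \<subseteq> {1..\<rho>}" and Nsum: "sum_mset N = s"
    using N by (simp_all add: Y_partitions_def)
  have Nc: "count N i \<le> l" for i
    using N by (cases "i \<in># N") (auto simp: Y_partitions_def not_in_iff)
  have "set_mset (unit_parts N) \<subseteq> range (\<lambda>j. b ^ j) \<times> {1..\<rho>}"
    using set_unit_parts[of N] Ns by (force intro: range_eqI[of _ _ 0])
  moreover have "set_mset (raise_parts b M) \<subseteq> range (\<lambda>j. b ^ j) \<times> {1..\<rho>}"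
  proof
    fix x assume "x \<in># raise_parts b M"
    then obtain j i where "x = (b * b ^ j, i)" "i \<in> {1..\<rho>}"
      using Ms by (force simp: raise_parts_def)
    then show "x \<in> range (\<lambda>j. b ^ j) \<times> {1..\<rho>}"
      by (auto intro: range_eqI[of _ _ "Suc j"])
  qed
  moreover have "\<exists>t\<le>l. count ?G (p, i) = t * i" for p i
  proof (cases "b dvd p")
    case True
    then obtain q where "p = b * q" by blast
    then show ?thesis using Mc count_glued_mult[OF b] by simp
  next
    case False
    then show ?thesis
      using Nc by (auto simp: count_unit_parts count_raise_parts_not_dvd intro: exI[of _ 0])
  qed
  ultimately show ?thesis
    unfolding mem_C_partitions_iff by (simp add: sum_unit_parts sum_raise_parts Nsum Mr)
qed

text \<open>
  Surjectivity: the allowed multiplicities of \<open>(1, i)\<close> are divisible by \<open>i\<close>, so the units split into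
  bundles; every other occurring size is a positive power of \<open>b\<close>, so its quotient by \<open>b\<close> is again
  a power.
\<close>

lemma C_partitions_glued:
  assumes b: "b \<ge> 2" and G: "G \<in> C_partitions b \<rho> l (int m)"
  obtains N M where "G = unit_parts N + raise_parts b M"
    and "N \<in> Y_partitions \<rho> l (sum_mset N)" and "M \<in> C_partitions b \<rho> l (int (\<Sum>x\<in>#M. fst x))"
proof -
  have Gs: "set_mset G \<subseteq> range (\<lambda>j. b ^ j) \<times> {1..\<rho>}"
    and Gc: "\<And>p i. \<exists>t\<le>l. count G (p, i) = t * i"
    using G by (simp_all add: mem_C_partitions_iff)
  define N where "N = (\<Sum>i\<in>{1..\<rho>}. replicate_mset (count G (1, i) div i) i)"
  define M where "M = image_mset (apfst (\<lambda>p. p div b)) {#x \<in># G. fst x \<noteq> 1#}"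
  have count_N: "count N i = (if i \<in> {1..\<rho>} then count G (1, i) div i else 0)" for i
    unfolding N_def by (simp add: count_sum)
  have Nc: "count N i * i = count G (1, i)" for i
  proof (cases "i \<in> {1..\<rho>}")
    case True
    then show ?thesis using Gc[of 1 i] by (auto simp: count_N)
  next
    case False
    then have "(1, i) \<notin># G" using Gs by auto
    then show ?thesis using False by (simp add: count_N not_in_iff)
  qed
  have larger: "\<exists>j. fst x = b * b ^ j" if x: "x \<in># G" "fst x \<noteq> 1" for x
  proof -
    obtain j where "fst x = b ^ j" using Gs x(1) by force
    then show ?thesis using x(2) by (cases j) auto
  qed
  have raise: "raise_parts b M = {#x \<in># G. fst x \<noteq> 1#}"
  proof -
    have "raise_parts b M = image_mset (\<lambda>x. x) {#x \<in># G. fst x \<noteq> 1#}"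
      unfolding raise_parts_def M_def multiset.map_comp
    proof (rule image_mset_cong)
      fix x assume "x \<in># {#x \<in># G. fst x \<noteq> 1#}"
      then show "(apfst ((*) b) \<circ> apfst (\<lambda>p. p div b)) x = x"
        using larger[of x] by (cases x) auto
    qed
    then show ?thesis by simp
  qed
  have "unit_parts N = {#x \<in># G. fst x = 1#}"
    by (rule multiset_eqI) (auto simp: count_unit_parts Nc)
  then have 1: "G = unit_parts N + raise_parts b M"
    using raise multiset_partition[of G "\<lambda>x. fst x = 1"] by simp
  have "set_mset N \<subseteq> {1..\<rho>}"
    unfolding N_def by (auto simp: set_mset_sum split: if_splits)
  moreover have "count N i \<le> l" for i
  proof (cases "i \<in> {1..\<rho>}")
    case True
    then show ?thesis using Gc[of 1 i] by (auto simp: count_N)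
  qed (auto simp: count_N)
  ultimately have 2: "N \<in> Y_partitions \<rho> l (sum_mset N)"
    by (simp add: Y_partitions_def)
  have "set_mset M \<subseteq> range (\<lambda>j. b ^ j) \<times> {1..\<rho>}"
  proof
    fix x assume "x \<in># M"
    then obtain y where y: "y \<in># G" "fst y \<noteq> 1" "x = apfst (\<lambda>p. p div b) y"
      by (auto simp: M_def)
    then obtain j where "fst y = b * b ^ j" using larger by blast
    then have "x = (b ^ j, snd y)" using y(3) b by (cases y) auto
    then show "x \<in> range (\<lambda>j. b ^ j) \<times> {1..\<rho>}" using Gs y(1) by auto
  qed
  moreover have "count M (p, i) = count G (b * p, i)" for p i
    using count_glued_mult[OF b] 1 by simp
  ultimately have 3: "M \<in> C_partitions b \<rho> l (int (\<Sum>x\<in>#M. fst x))"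
    unfolding mem_C_partitions_iff using Gc by simp
  show thesis using that[OF 1 2 3] .
qed

text \<open>
  The partitioned number \<open>r\<close> of the second component is carried along as a tag, which makes the
  domain of the bijection a disjoint union; it adds no freedom, as \<open>M\<close> determines it.
\<close>

lemma C_recurrence:
  assumes b: "b \<ge> 2"
  shows "C b \<rho> l (int m) = (\<Sum>r\<le>m div b. Y \<rho> l (m - b * r) * C b \<rho> l (int r))"
proof -
  let ?D = "Sigma {..m div b} (\<lambda>r. Y_partitions \<rho> l (m - b * r) \<times> C_partitions b \<rho> l (int r))"
  let ?f = "\<lambda>(r::nat, N, M). unit_parts N + raise_parts b M"
  have inj: "inj_on ?f ?D"
  proof (rule inj_onI)
    fix u v assume u: "u \<in> ?D" and v: "v \<in> ?D" and eq: "?f u = ?f v"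
    obtain r N M r' N' M' where uv: "u = (r, N, M)" "v = (r', N', M')" by (metis prod_cases3)
    have "set_mset N \<subseteq> {1..\<rho>}" "set_mset N' \<subseteq> {1..\<rho>}"
      using u v uv by (simp_all add: Y_partitions_def)
    then have "0 \<notin># N" "0 \<notin># N'" by auto
    moreover have "unit_parts N + raise_parts b M = unit_parts N' + raise_parts b M'"
      using eq uv by simp
    ultimately have "N = N' \<and> M = M'" by (rule glued_inject[OF b])
    moreover have "(\<Sum>x\<in>#M. fst x) = r" "(\<Sum>x\<in>#M'. fst x) = r'"
      using u v uv by (simp_all add: mem_C_partitions_iff)
    ultimately show "u = v" using uv by simp
  qed
  have image: "?f ` ?D = C_partitions b \<rho> l (int m)"
  proof (intro equalityI subsetI)
    fix G assume "G \<in> ?f ` ?D"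
    then obtain u where u: "u \<in> ?D" "G = ?f u" by (rule imageE)
    obtain r N M where urNM: "u = (r, N, M)" by (metis prod_cases3)
    have r: "r \<le> m div b" and N: "N \<in> Y_partitions \<rho> l (m - b * r)"
      and M: "M \<in> C_partitions b \<rho> l (int r)" and G: "G = unit_parts N + raise_parts b M"
      using u urNM by simp_all
    have "b * r \<le> m"
      by (rule order_trans[OF mult_le_mono2[OF r] times_div_less_eq_dividend])
    then show "G \<in> C_partitions b \<rho> l (int m)"
      using glued_mem_C_partitions[OF b N M] G by simp
  next
    fix G assume G: "G \<in> C_partitions b \<rho> l (int m)"
    then obtain N M where NM: "G = unit_parts N + raise_parts b M"
      "N \<in> Y_partitions \<rho> l (sum_mset N)" "M \<in> C_partitions b \<rho> l (int (\<Sum>x\<in>#M. fst x))"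
      using C_partitions_glued[OF b] by blast
    define r where "r = (\<Sum>x\<in>#M. fst x)"
    have m: "m = sum_mset N + b * r"
      using G unfolding NM(1) mem_C_partitions_iff
      by (simp add: sum_unit_parts sum_raise_parts r_def)
    then have "r \<le> m div b"
      using b by (simp add: less_eq_div_iff_mult_less_eq mult.commute)
    then have "(r, N, M) \<in> ?D" using NM(2,3) m by (simp add: r_def)
    then show "G \<in> ?f ` ?D" by (rule rev_image_eqI) (simp add: NM(1))
  qed
  have "card (C_partitions b \<rho> l (int m)) = card ?D"
    using card_image[OF inj] unfolding image .
  also have "\<dots> = (\<Sum>r\<le>m div b. Y \<rho> l (m - b * r) * C b \<rho> l (int r))"
    using finite_C_partitions[OF b] finite_Y_partitions
    by (simp add: card_SigmaI Y_def C_def card_cartesian_product)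
  finally show ?thesis by (simp only: C_def)
qed

section \<open>The range of summation\<close>

lemma sum_mset_eq_sum_count:
  fixes N :: "nat multiset"
  assumes "finite A" and "set_mset N \<subseteq> A"
  shows "sum_mset N = (\<Sum>i\<in>A. count N i * i)"
  using assms(2)
proof (induction N)
  case (add x N)
  have "(\<Sum>i\<in>A. count (add_mset x N) i * i) = (\<Sum>i\<in>A. count N i * i + (if i = x then i else 0))"
    by (rule sum.cong) auto
  also have "\<dots> = sum_mset N + x"
    using add assms(1) by (simp add: sum.distrib)
  finally show ?case by simp
qed simp

lemma Y_eq_0:
  assumes "s > l * \<rho> * (\<rho> + 1) div 2"
  shows "Y \<rho> l s = 0"
proof -
  have "s \<le> l * \<rho> * (\<rho> + 1) div 2" if N: "N \<in> Y_partitions \<rho> l s" for N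
  proof -
    have Ns: "set_mset N \<subseteq> {1..\<rho>}" and Nsum: "sum_mset N = s"
      using N by (simp_all add: Y_partitions_def)
    have Nc: "count N i \<le> l" for i
      using N by (cases "i \<in># N") (auto simp: Y_partitions_def not_in_iff)
    have "s = (\<Sum>i\<in>{1..\<rho>}. count N i * i)"
      using sum_mset_eq_sum_count[OF _ Ns] Nsum by simp
    also have "\<dots> \<le> (\<Sum>i\<in>{1..\<rho>}. l * i)"
      using Nc by (intro sum_mono mult_le_mono1)
    finally have "2 * s \<le> l * (2 * (\<Sum>i=1..\<rho>. i))"
      by (simp add: sum_distrib_left[symmetric])
    also have "2 * (\<Sum>i=1..\<rho>. i) = \<rho> * (\<rho> + 1)"
      using double_gauss_sum_from_Suc_0[of \<rho>, where ?'a = nat] by simp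
    finally show ?thesis
      by (simp add: less_eq_div_iff_mult_less_eq algebra_simps)
  qed
  then have "Y_partitions \<rho> l s = {}" using assms by force
  then show ?thesis by (simp add: Y_def)
qed

theorem proposition4p8:
  fixes \<rho> l b lam :: nat
  assumes "\<rho> \<ge> 1" and "l \<ge> 1" and "b \<ge> 2"
    and "lam = l * \<rho> * (\<rho> + 1) div 2"
  shows "\<forall>n::nat. \<forall>j\<in>{0..b - 1}.
    C b \<rho> l (int (b * n + j)) = (\<Sum>k=0..lam div b. Y \<rho> l (b * k + j) * C b \<rho> l (int n - int k))"
proof (intro allI ballI)
  fix n j :: nat
  assume "j \<in> {0..b - 1}"
  then have j: "j < b" using assms(3) by auto
  let ?h = "\<lambda>k. Y \<rho> l (b * k + j) * C b \<rho> l (int n - int k)"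
  \<comment> \<open>The two facts that make the ranges \<open>k \<le> n\<close> and \<open>k \<le> lam div b\<close> interchangeable.\<close>
  have h_large: "?h k = 0" if "k > n" for k
    using that by (simp add: C_neg)
  have h_lam: "?h k = 0" if "k > lam div b" for k
  proof -
    have "lam < b * k"
      using that assms(3) by (simp add: div_less_iff_less_mult mult.commute)
    then show ?thesis using Y_eq_0[of l \<rho> "b * k + j"] assms(4) by simp
  qed
  have "C b \<rho> l (int (b * n + j)) = (\<Sum>r\<le>n. Y \<rho> l (b * n + j - b * r) * C b \<rho> l (int r))"
    using C_recurrence[OF assms(3), of \<rho> l "b * n + j"] j by simp
  also have "\<dots> = (\<Sum>k\<le>n. ?h k)"
  proof (rule sum.reindex_bij_witness[of _ "\<lambda>k. n - k" "\<lambda>r. n - r"])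
    fix r assume "r \<in> {..n}"
    then show "?h (n - r) = Y \<rho> l (b * n + j - b * r) * C b \<rho> l (int r)"
      by (simp add: diff_mult_distrib2)
  qed auto
  also have "\<dots> = (\<Sum>k\<le>max n (lam div b). ?h k)"
    using h_large by (intro sum.mono_neutral_left) auto
  also have "\<dots> = (\<Sum>k=0..lam div b. ?h k)"
    using h_lam by (intro sum.mono_neutral_right) auto
  finally show "C b \<rho> l (int (b * n + j)) = (\<Sum>k=0..lam div b. ?h k)" .
qed

end
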